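(* For all $\alpha\in I_r$ and all $j,k\in\mathbb Z$, the solution $T_{\alpha,j,k}$ of the $A_r$ $T$-system is a positive Laurent polynomial of the initial data $\{T_{\beta,i,0},T_{\beta,i,1}\}_{\beta\in I_r,\,i\in\mathbb Z}$, i.e. a Laurent polynomial in these variables with non-negative coefficients.
   Context: Fix $r\ge1$, $I_r=\{1,\dots,r\}$. Let $\{T_{\alpha,j,0},T_{\alpha,j,1}:\alpha\in I_r,\ j\in\mathbb Z\}$ be independent commuting variables. The $A_r$ $T$-system is $T_{\alpha,j,k+1}T_{\alpha,j,k-1}=T_{\alpha,j+1,k}T_{\alpha,j-1,k}+T_{\alpha+1,j,k}T_{\alpha-1,j,k}$ for $\alpha\in I_r$, $j,k\in\mathbb Z$, with $T_{0,j,k}=T_{r+1,j,k}=1$; it determines every $T_{\alpha,j,k}$ as an element of the field of rational functions in the initial variables. *)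

theory Defs
  imports
    "HOL-Library.Poly_Mapping"
    "HOL-Library.Product_Lexorder"
    "HOL-Computational_Algebra.Fraction_Field"
begin

text \<open>
  An index \<open>(\<alpha>, j, k)\<close> names the indeterminate \<open>T\<^sub>\<alpha>\<^sub>,\<^sub>j\<^sub>,\<^sub>k\<close>; only those in \<open>init_indices r\<close>
  are initial data. The product order on indices matters only for the library's integral domain
  instance of \<open>\<Rightarrow>\<^sub>0\<close>. The fraction field of the integer polynomials in these
  indeterminates is the field of rational functions (with rational coefficients) in them.
\<close>

type_synonym index = "nat \<times> int \<times> int"

type_synonym ratfun = "((index \<Rightarrow>\<^sub>0 nat) \<Rightarrow>\<^sub>0 int) fract"

definition init_indices :: "nat \<Rightarrow> index set" where
  "init_indices r = {1..r} \<times> UNIV \<times> {0, 1}"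

definition indet :: "index \<Rightarrow> ratfun" where
  "indet v = Fract (Poly_Mapping.single (Poly_Mapping.single v 1) 1) 1"

definition T_system :: "nat \<Rightarrow> (nat \<Rightarrow> int \<Rightarrow> int \<Rightarrow> 'a::field) \<Rightarrow> bool" where
  "T_system r T \<longleftrightarrow>
     (\<forall>j k. T 0 j k = 1 \<and> T (r + 1) j k = 1) \<and>
     (\<forall>\<alpha>\<in>{1..r}. \<forall>j k.
        T \<alpha> j (k + 1) * T \<alpha> j (k - 1) =
        T \<alpha> (j + 1) k * T \<alpha> (j - 1) k + T (\<alpha> + 1) j k * T (\<alpha> - 1) j k)"

definition T_system_solution :: "nat \<Rightarrow> (nat \<Rightarrow> int \<Rightarrow> int \<Rightarrow> ratfun) \<Rightarrow> bool" where
  "T_system_solution r T \<longleftrightarrow>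
     T_system r T \<and> (\<forall>(\<alpha>, j, k)\<in>init_indices r. T \<alpha> j k = indet (\<alpha>, j, k))"

text \<open>
  A Laurent polynomial with integer coefficients is a finitely supported map from integer exponent
  vectors to coefficients; \<open>laurent_eval\<close> reads it as a rational function.
\<close>

type_synonym laurent = "(index \<Rightarrow>\<^sub>0 int) \<Rightarrow>\<^sub>0 int"

definition laurent_monom :: "(index \<Rightarrow>\<^sub>0 int) \<Rightarrow> ratfun" where
  "laurent_monom m = (\<Prod>v\<in>Poly_Mapping.keys m. indet v powi Poly_Mapping.lookup m v)"

definition laurent_eval :: "laurent \<Rightarrow> ratfun" where
  "laurent_eval p =
     (\<Sum>m\<in>Poly_Mapping.keys p. of_int (Poly_Mapping.lookup p m) * laurent_monom m)"

definition positive_laurent :: "index set \<Rightarrow> ratfun \<Rightarrow> bool" where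
  "positive_laurent V f \<longleftrightarrow>
     (\<exists>p. (\<forall>m\<in>Poly_Mapping.keys p. Poly_Mapping.keys m \<subseteq> V \<and> Poly_Mapping.lookup p m \<ge> 0) \<and>
          f = laurent_eval p)"

subsection \<open>The initial data determine a unique solution\<close>

definition nonneg_poly :: "('a \<Rightarrow>\<^sub>0 int) \<Rightarrow> bool" where
  "nonneg_poly p \<longleftrightarrow> (\<forall>m. Poly_Mapping.lookup p m \<ge> 0)"

definition subtraction_free :: "ratfun \<Rightarrow> bool" where
  "subtraction_free f \<longleftrightarrow>
     (\<exists>a b. nonneg_poly a \<and> nonneg_poly b \<and> a \<noteq> 0 \<and> b \<noteq> 0 \<and> f = Fract a b)"

lemma nonneg_poly_add: "nonneg_poly a \<Longrightarrow> nonneg_poly b \<Longrightarrow> nonneg_poly (a + b)"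
  by (simp add: nonneg_poly_def lookup_add)

lemma nonneg_poly_add_eq_0:
  assumes "nonneg_poly a" "nonneg_poly b" "a + b = 0"
  shows "a = 0"
proof (rule poly_mapping_eqI)
  fix m
  have "Poly_Mapping.lookup a m + Poly_Mapping.lookup b m = 0"
    using assms(3) by (metis lookup_add lookup_zero)
  then show "Poly_Mapping.lookup a m = Poly_Mapping.lookup 0 m"
    using assms(1,2) unfolding nonneg_poly_def by (smt (verit) lookup_zero)
qed

lemma nonneg_poly_mult:
  fixes a b :: "'a::comm_monoid_add \<Rightarrow>\<^sub>0 int"
  assumes "nonneg_poly a" "nonneg_poly b"
  shows "nonneg_poly (a * b)"
  using assms unfolding nonneg_poly_def lookup_mult Sum_any.expand_set
  by (auto intro!: sum_nonneg mult_nonneg_nonneg simp: when_def)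

lemma subtraction_free_nonzero: "subtraction_free f \<Longrightarrow> f \<noteq> 0"
  by (auto simp: subtraction_free_def Zero_fract_def eq_fract)

lemma subtraction_free_one: "subtraction_free 1"
  unfolding subtraction_free_def One_fract_def
  by (intro exI[of _ 1]) (simp add: nonneg_poly_def lookup_one when_def)

lemma subtraction_free_indet: "subtraction_free (indet v)"
proof -
  let ?x = "Poly_Mapping.single (Poly_Mapping.single v 1) 1 :: (index \<Rightarrow>\<^sub>0 nat) \<Rightarrow>\<^sub>0 int"
  have "nonneg_poly ?x" "nonneg_poly (1 :: (index \<Rightarrow>\<^sub>0 nat) \<Rightarrow>\<^sub>0 int)"
    by (auto simp: nonneg_poly_def lookup_single lookup_one when_def)
  moreover have "?x \<noteq> 0"
    by (metis lookup_single_eq lookup_zero zero_neq_one)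
  ultimately show ?thesis
    unfolding subtraction_free_def indet_def by (metis zero_neq_one)
qed

lemma subtraction_free_add:
  assumes "subtraction_free f" "subtraction_free g"
  shows "subtraction_free (f + g)"
proof -
  obtain a b where f: "nonneg_poly a" "nonneg_poly b" "a \<noteq> 0" "b \<noteq> 0" "f = Fract a b"
    using assms(1) unfolding subtraction_free_def by blast
  obtain c d where g: "nonneg_poly c" "nonneg_poly d" "c \<noteq> 0" "d \<noteq> 0" "g = Fract c d"
    using assms(2) unfolding subtraction_free_def by blast
  have nn: "nonneg_poly (a * d)" "nonneg_poly (c * b)" "nonneg_poly (b * d)"
    using f g by (simp_all add: nonneg_poly_mult)
  have "a * d \<noteq> 0" using f g by simp
  then have "a * d + c * b \<noteq> 0" using nonneg_poly_add_eq_0 nn by blast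
  moreover have "f + g = Fract (a * d + c * b) (b * d)" using f g by simp
  ultimately show ?thesis
    unfolding subtraction_free_def using f(4) g(4) nn nonneg_poly_add by (metis no_zero_divisors)
qed

lemma subtraction_free_mult:
  assumes "subtraction_free f" "subtraction_free g"
  shows "subtraction_free (f * g)"
  using assms unfolding subtraction_free_def
  by (metis mult_fract no_zero_divisors nonneg_poly_mult)

lemma subtraction_free_divide:
  assumes "subtraction_free f" "subtraction_free g"
  shows "subtraction_free (f / g)"
  using assms unfolding subtraction_free_def
  by (metis divide_fract no_zero_divisors nonneg_poly_mult)

definition T_step ::
  "nat \<Rightarrow> (nat \<Rightarrow> int \<Rightarrow> ratfun) \<Rightarrow> (nat \<Rightarrow> int \<Rightarrow> ratfun) \<Rightarrow> nat \<Rightarrow> int \<Rightarrow> ratfun" where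
  "T_step r A B \<alpha> j =
     (if \<alpha> \<in> {1..r}
      then (B \<alpha> (j + 1) * B \<alpha> (j - 1) + B (\<alpha> + 1) j * B (\<alpha> - 1) j) / A \<alpha> j
      else 1)"

fun T_iter ::
  "nat \<Rightarrow> (nat \<Rightarrow> int \<Rightarrow> ratfun) \<Rightarrow> (nat \<Rightarrow> int \<Rightarrow> ratfun) \<Rightarrow> nat \<Rightarrow> nat \<Rightarrow> int \<Rightarrow> ratfun" where
  "T_iter r A B 0 = A"
| "T_iter r A B (Suc 0) = B"
| "T_iter r A B (Suc (Suc n)) = T_step r (T_iter r A B n) (T_iter r A B (Suc n))"

definition T_slice :: "nat \<Rightarrow> int \<Rightarrow> nat \<Rightarrow> int \<Rightarrow> ratfun" where
  "T_slice r k \<alpha> j = (if \<alpha> \<in> {1..r} then indet (\<alpha>, j, k) else 1)"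

definition T_sol :: "nat \<Rightarrow> nat \<Rightarrow> int \<Rightarrow> int \<Rightarrow> ratfun" where
  "T_sol r \<alpha> j k =
     (if k \<ge> 0 then T_iter r (T_slice r 0) (T_slice r 1) (nat k) \<alpha> j
      else T_iter r (T_slice r 1) (T_slice r 0) (nat (1 - k)) \<alpha> j)"

lemma T_iter_subtraction_free:
  assumes "\<And>\<alpha> j. subtraction_free (A \<alpha> j)" "\<And>\<alpha> j. subtraction_free (B \<alpha> j)"
  shows "subtraction_free (T_iter r A B n \<alpha> j)"
  using assms
proof (induction r A B n arbitrary: \<alpha> j rule: T_iter.induct)
  case (3 r A B n)
  then show ?case
    by (auto simp: T_step_def
        intro!: subtraction_free_divide subtraction_free_add subtraction_free_mult
          subtraction_free_one)
qed auto

lemma T_slice_subtraction_free: "subtraction_free (T_slice r k \<alpha> j)"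
  by (simp add: T_slice_def subtraction_free_indet subtraction_free_one)

lemma T_sol_subtraction_free: "subtraction_free (T_sol r \<alpha> j k)"
  by (simp add: T_sol_def T_iter_subtraction_free T_slice_subtraction_free)

lemma T_sol_slice:
  "T_sol r \<alpha> j 0 = T_slice r 0 \<alpha> j" "T_sol r \<alpha> j 1 = T_slice r 1 \<alpha> j"
  by (simp_all add: T_sol_def)

lemma T_sol_neg:
  "k \<le> 1 \<Longrightarrow> T_sol r \<alpha> j k = T_iter r (T_slice r 1) (T_slice r 0) (nat (1 - k)) \<alpha> j"
  by (cases "k = 0"; cases "k = 1") (auto simp: T_sol_def)

lemma T_sol_up:
  assumes "k \<ge> 1"
  shows "T_sol r \<alpha> j (k + 1) = T_step r (\<lambda>\<alpha> j. T_sol r \<alpha> j (k - 1)) (\<lambda>\<alpha> j. T_sol r \<alpha> j k) \<alpha> j"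
proof -
  define n where "n = nat (k - 1)"
  have "k = int n + 1" using assms by (simp add: n_def)
  then have "nat (k + 1) = Suc (Suc n)" "nat k = Suc n" "nat (k - 1) = n" by auto
  then show ?thesis using assms by (simp add: T_sol_def T_step_def)
qed

lemma T_sol_down:
  assumes "k \<le> 0"
  shows "T_sol r \<alpha> j (k - 1) = T_step r (\<lambda>\<alpha> j. T_sol r \<alpha> j (k + 1)) (\<lambda>\<alpha> j. T_sol r \<alpha> j k) \<alpha> j"
proof -
  define n where "n = nat (- k)"
  have "k = - int n" using assms by (simp add: n_def)
  then have "nat (1 - (k - 1)) = Suc (Suc n)" "nat (1 - k) = Suc n" "nat (1 - (k + 1)) = n" by auto
  then show ?thesis using assms by (simp add: T_sol_neg T_step_def)
qed

lemma T_sol_solution: "T_system_solution r (T_sol r)"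
proof -
  have step_outside: "T_iter r (T_slice r a) (T_slice r b) n \<alpha> j = 1" if "\<alpha> \<notin> {1..r}" for a b n \<alpha> j
    using that by (induction n rule: induct_nat_012) (auto simp: T_step_def T_slice_def)
  have rel: "T_sol r \<alpha> j (k + 1) * T_sol r \<alpha> j (k - 1) =
      T_sol r \<alpha> (j + 1) k * T_sol r \<alpha> (j - 1) k + T_sol r (\<alpha> + 1) j k * T_sol r (\<alpha> - 1) j k"
    if "\<alpha> \<in> {1..r}" for \<alpha> j k
  proof (cases "k \<ge> 1")
    case True
    have "T_sol r \<alpha> j (k - 1) \<noteq> 0"
      using T_sol_subtraction_free subtraction_free_nonzero by blast
    then show ?thesis using that by (simp add: T_sol_up[OF True] T_step_def)
  next
    case False
    then have "k \<le> 0" by simp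
    have "T_sol r \<alpha> j (k + 1) \<noteq> 0"
      using T_sol_subtraction_free subtraction_free_nonzero by blast
    then show ?thesis using that by (simp add: T_sol_down[OF \<open>k \<le> 0\<close>] T_step_def)
  qed
  have "T_sol r 0 j k = 1 \<and> T_sol r (r + 1) j k = 1" for j k
    by (simp add: T_sol_def step_outside)
  with rel have "T_system r (T_sol r)"
    unfolding T_system_def by blast
  then show ?thesis
    by (auto simp: T_system_solution_def init_indices_def T_sol_slice T_slice_def)
qed

lemma T_system_solution_unique:
  assumes sol: "T_system_solution r T" and \<alpha>: "\<alpha> \<le> r + 1"
  shows "T \<alpha> j k = T_sol r \<alpha> j k"
proof -
  let ?S = "T_sol r"
  define E where "E k \<longleftrightarrow> (\<forall>\<alpha> j. \<alpha> \<le> r + 1 \<longrightarrow> T \<alpha> j k = ?S \<alpha> j k)" for k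
  have sT: "T_system r T" and sS: "T_system r ?S"
    using sol T_sol_solution by (auto simp: T_system_solution_def)
  have bd: "T \<alpha> j k = ?S \<alpha> j k" if "\<alpha> \<le> r + 1" "\<alpha> \<notin> {1..r}" for \<alpha> j k
  proof -
    have "\<alpha> = 0 \<or> \<alpha> = r + 1" using that by auto
    then show ?thesis using sT sS unfolding T_system_def by metis
  qed
  have init: "T \<alpha> j k = ?S \<alpha> j k" if "\<alpha> \<in> {1..r}" "k = 0 \<or> k = 1" for \<alpha> j k
    using sol T_sol_solution[of r] that unfolding T_system_solution_def init_indices_def by fastforce
  have E01: "E 0" "E 1"
    using bd init unfolding E_def by blast+
  have prod: "T \<alpha> j (k + 1) * T \<alpha> j (k - 1) = ?S \<alpha> j (k + 1) * ?S \<alpha> j (k - 1)"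
    if "E k" "\<alpha> \<in> {1..r}" for \<alpha> j k
  proof -
    have "T \<alpha> i k = ?S \<alpha> i k" "T (\<alpha> + 1) i k = ?S (\<alpha> + 1) i k" "T (\<alpha> - 1) i k = ?S (\<alpha> - 1) i k" for i
      using that by (auto simp: E_def)
    then show ?thesis using sT sS that(2) unfolding T_system_def by metis
  qed
  have nz: "?S \<alpha> j k \<noteq> 0" for \<alpha> j k
    using T_sol_subtraction_free subtraction_free_nonzero by blast
  have up: "E (k + 1)" if "E k" "E (k - 1)" for k
    unfolding E_def
  proof (intro allI impI)
    fix \<alpha> j assume a: "\<alpha> \<le> r + 1"
    show "T \<alpha> j (k + 1) = ?S \<alpha> j (k + 1)"
    proof (cases "\<alpha> \<in> {1..r}")
      case True
      have "T \<alpha> j (k - 1) = ?S \<alpha> j (k - 1)" using that(2) a by (simp add: E_def)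
      then show ?thesis using prod[OF that(1) True, of j] nz[of \<alpha> j "k - 1"] by simp
    qed (use a bd in blast)
  qed
  have down: "E (k - 1)" if "E k" "E (k + 1)" for k
    unfolding E_def
  proof (intro allI impI)
    fix \<alpha> j assume a: "\<alpha> \<le> r + 1"
    show "T \<alpha> j (k - 1) = ?S \<alpha> j (k - 1)"
    proof (cases "\<alpha> \<in> {1..r}")
      case True
      have "T \<alpha> j (k + 1) = ?S \<alpha> j (k + 1)" using that(2) a by (simp add: E_def)
      then show ?thesis using prod[OF that(1) True, of j] nz[of \<alpha> j "k + 1"] by simp
    qed (use a bd in blast)
  qed
  have "E k \<and> E (k + 1)" for k
  proof (induction k rule: int_induct[of _ 0])
    case base
    show ?case using E01 by simp
  next
    case (step1 i)
    then show ?case using up[of "i + 1"] by simp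
  next
    case (step2 i)
    then show ?case using down[of i] by simp
  qed
  then show ?thesis using \<alpha> by (simp add: E_def)
qed

end

theory Submission
  imports Defs
begin

text \<open>
  Idea: a transfer-matrix (network) solution in the spirit of Di Francesco and Kedem. Two families
  of elementary operators with subtraction-free Laurent entries satisfy
  an exchange relation \<open>V U = U V\<close> whose parameters are related exactly by the $T$-system. Suitably
  normalised by initial data, a vacuum amplitude of a product of these operators along the surface
  at height \<open>n\<close> equals one along a shorter stretch of the surface at height \<open>n + 1\<close>, and over the
  empty stretch it is a single $T_{\alpha,j,k}$. Pushing the surface down to the initial data
  therefore expresses $T_{\alpha,j,k}$ through sums and products of
  initial variables and their inverses. The operators act on sets of particles rather than on
  single particles (they are exterior powers of $2 \times 2$ blocks), so no determinants appear.
\<close>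

section \<open>Local operators and their commutation relations\<close>

text \<open>
  Functions of occupation patterns \<open>nat \<Rightarrow> bool\<close>: the fermionic Fock space. On the one-particle
  states at sites \<open>s\<close>, \<open>s + 1\<close> the chips are the matrices with rows \<open>(a/b, v/b), (0, 1)\<close> for
  \<open>chip_V\<close> and \<open>(1, 0), (u/b, a/b)\<close> for \<open>chip_U\<close>; on the doubly occupied state they act by
  their determinant \<open>a/b\<close>.
\<close>

type_synonym 'a operator = "((nat \<Rightarrow> bool) \<Rightarrow> 'a) \<Rightarrow> (nat \<Rightarrow> bool) \<Rightarrow> 'a"

definition chip_V :: "nat \<Rightarrow> 'a::field \<Rightarrow> 'a \<Rightarrow> 'a \<Rightarrow> 'a operator" where
  "chip_V s v a b f I =
     (if I s then a / b * f I + (if I (Suc s) then 0 else v / b * f (I(s := False, Suc s := True)))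
      else f I)"

definition chip_U :: "nat \<Rightarrow> 'a::field \<Rightarrow> 'a \<Rightarrow> 'a \<Rightarrow> 'a operator" where
  "chip_U s a b u f I =
     (if I (Suc s) then a / b * f I + (if I s then 0 else u / b * f (I(s := True, Suc s := False)))
      else f I)"

text \<open>On empty and doubly occupied pairs both sides act by 1 and \<open>a / c\<close>. On the
  one-particle states the off-diagonal entries agree, and equality of the diagonal entries is the
  hypothesis divided by \<open>b * c\<close> or by \<open>b' * c\<close>.\<close>

lemma chip_exchange:
  fixes a b b' c u v :: "'a::field"
  assumes "b' * b = c * a + u * v" "a \<noteq> 0" "b \<noteq> 0" "b' \<noteq> 0" "c \<noteq> 0"
  shows "chip_U s a b' u \<circ> chip_V s v b' c = chip_V s v a b \<circ> chip_U s b c u"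
proof -
  have *: "b' / c = a / b + u * v / (b * c)" "b / c = a / b' + u * v / (b' * c)"
    using assms by (auto simp: divide_simps) (simp_all add: algebra_simps)
  have same: "I(s := False, Suc s := True) = I" if "\<not> I s" "I (Suc s)" for I :: "nat \<Rightarrow> bool"
    using that by (simp add: fun_eq_iff)
  have same': "I(s := True, Suc s := False) = I" if "I s" "\<not> I (Suc s)" for I :: "nat \<Rightarrow> bool"
    using that by (simp add: fun_eq_iff)
  have twist: "I(Suc s := y, s := x) = I(s := x, Suc s := y)" for I :: "nat \<Rightarrow> bool" and x y
    by (simp add: fun_eq_iff)
  show ?thesis
  proof (intro ext)
    fix f I
    show "(chip_U s a b' u \<circ> chip_V s v b' c) f I = (chip_V s v a b \<circ> chip_U s b c u) f I"
    proof (cases "I s = I (Suc s)")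
      case True
      then show ?thesis
        using assms(2-) by (cases "I s") (simp_all add: chip_U_def chip_V_def)
    next
      case False
      show ?thesis
      proof (cases "I s")
        case True
        with False show ?thesis
          using assms(2-) by (simp add: chip_U_def chip_V_def twist same' *(1)) (simp add: field_simps)
      next
        case f: False
        with False show ?thesis
          using assms(2-) by (simp add: chip_U_def chip_V_def twist same *(2)) (simp add: field_simps)
      qed
    qed
  qed
qed

text \<open>Both chips move a particle out of the shared site \<open>Suc s\<close>. Whichever acts
  second misses a particle that has left, and its diagonal factor is lost; the changed coefficients
  compensate, by \<open>a / b * (b / d) = a / d\<close> and
  \<open>c / b = c / d * (d / b)\<close>.\<close>

lemma chip_flip:
  fixes a b c d :: "'a::field"
  assumes "a \<noteq> 0" "b \<noteq> 0" "c \<noteq> 0" "d \<noteq> 0"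
  shows "chip_U s a b c \<circ> chip_V (Suc s) b c d = chip_V (Suc s) a c d \<circ> chip_U s a b d"
proof (intro ext)
  fix f :: "(nat \<Rightarrow> bool) \<Rightarrow> 'a" and I :: "nat \<Rightarrow> bool"
  have twist: "I(s := x, Suc s := y, Suc s := z, Suc (Suc s) := w) = I(s := x, Suc s := z, Suc (Suc s) := w)"
    "I(Suc s := x, Suc (Suc s) := y, s := z, Suc s := w) = I(s := z, Suc s := w, Suc (Suc s) := y)" for x y z w
    by (simp_all add: fun_eq_iff)
  show "(chip_U s a b c \<circ> chip_V (Suc s) b c d) f I = (chip_V (Suc s) a c d \<circ> chip_U s a b d) f I"
    using assms
    by (cases "I s"; cases "I (Suc s)"; cases "I (Suc (Suc s))")
       (simp_all add: chip_U_def chip_V_def twist field_simps)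
qed

lemma fun_upd_swap_pairs:
  assumes "Suc s < s'"
  shows "I(s' := x, Suc s' := y, s := z, Suc s := w) = I(s := z, Suc s := w, s' := x, Suc s' := y)"
  using assms by (auto simp: fun_eq_iff)

lemma chip_commute_far:
  assumes "Suc s < s'"
  shows "chip_U s a b u \<circ> chip_V s' v' a' b' = chip_V s' v' a' b' \<circ> chip_U s a b u"
    and "chip_V s v a b \<circ> chip_U s' a' b' u' = chip_U s' a' b' u' \<circ> chip_V s v a b"
  using assms by (auto simp: fun_eq_iff chip_U_def chip_V_def fun_upd_swap_pairs add_divide_distrib algebra_simps)

text \<open>Here both chips move particles only into the shared site \<open>Suc s\<close>, and
  neither moves or weights a particle sitting there. A particle that enters blocks the other hop in
  either order.\<close>

lemma chip_commute_adjacent: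
  fixes a b a' b' u' v :: "'a::field"
  shows "chip_V s v a b \<circ> chip_U (Suc s) a' b' u' = chip_U (Suc s) a' b' u' \<circ> chip_V s v a b"
proof (intro ext)
  fix f :: "(nat \<Rightarrow> bool) \<Rightarrow> 'a" and I :: "nat \<Rightarrow> bool"
  have twist: "I(Suc s := x, Suc (Suc s) := y, s := z, Suc s := w) = I(s := z, Suc s := w, Suc (Suc s) := y)"
     for x y z w
    by (simp_all add: fun_eq_iff)
  show "(chip_V s v a b \<circ> chip_U (Suc s) a' b' u') f I = (chip_U (Suc s) a' b' u' \<circ> chip_V s v a b) f I"
    by (cases "I s"; cases "I (Suc s)"; cases "I (Suc (Suc s))")
       (simp_all add: chip_U_def chip_V_def twist add_divide_distrib algebra_simps)
qed

lemma chip_commute_U_V: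
  assumes "s < s'"
  shows "chip_V s v a b \<circ> chip_U s' a' b' u' = chip_U s' a' b' u' \<circ> chip_V s v a b"
  using assms chip_commute_far(2) chip_commute_adjacent by (metis Suc_lessI)

section \<open>Products of operators over the rows\<close>

primrec row_prod :: "(nat \<Rightarrow> 'b \<Rightarrow> 'b) \<Rightarrow> nat \<Rightarrow> 'b \<Rightarrow> 'b" where
  "row_prod x 0 = id"
| "row_prod x (Suc s) = row_prod x s \<circ> x (Suc s)"

lemma row_prod_commute:
  assumes "\<And>\<beta>. 1 \<le> \<beta> \<Longrightarrow> \<beta> \<le> s \<Longrightarrow> y \<beta> \<circ> z = z \<circ> y \<beta>"
  shows "row_prod y s \<circ> z = z \<circ> row_prod y s"
  using assms
proof (induction s)
  case (Suc s)
  have "row_prod y s \<circ> z = z \<circ> row_prod y s"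
    by (rule Suc.IH) (simp add: Suc.prems)
  moreover have "y (Suc s) \<circ> z = z \<circ> y (Suc s)"
    by (rule Suc.prems) simp_all
  ultimately show ?case by (simp add: fun_eq_iff)
qed simp

text \<open>Interleaving moves \<open>x \<alpha>\<close> leftwards past the \<open>y \<beta>\<close>
  of lower rows and past nothing else, which is why the hypothesis is one-sided.\<close>

lemma row_prod_mult:
  assumes "\<And>\<alpha> \<beta>. 1 \<le> \<beta> \<Longrightarrow> \<beta> < \<alpha> \<Longrightarrow> \<alpha> \<le> s \<Longrightarrow> y \<beta> \<circ> x \<alpha> = x \<alpha> \<circ> y \<beta>"
  shows "row_prod x s \<circ> row_prod y s = row_prod (\<lambda>\<alpha>. x \<alpha> \<circ> y \<alpha>) s"
  using assms
proof (induction s)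
  case (Suc s)
  have 1: "row_prod x s \<circ> row_prod y s = row_prod (\<lambda>\<alpha>. x \<alpha> \<circ> y \<alpha>) s"
    by (rule Suc.IH) (simp add: Suc.prems)
  have 2: "row_prod y s \<circ> x (Suc s) = x (Suc s) \<circ> row_prod y s"
    by (rule row_prod_commute, rule Suc.prems) simp_all
  show ?case unfolding row_prod.simps 1[symmetric] using 2 by (simp add: fun_eq_iff)
qed simp

lemma row_prod_cong:
  assumes "\<And>\<beta>. 1 \<le> \<beta> \<Longrightarrow> \<beta> \<le> s \<Longrightarrow> x \<beta> = y \<beta>"
  shows "row_prod x s = row_prod y s"
  using assms by (induction s) auto

section \<open>Vacuum states\<close>

definition filled :: "nat \<Rightarrow> nat \<Rightarrow> bool" where
  "filled \<alpha> \<beta> \<longleftrightarrow> 1 \<le> \<beta> \<and> \<beta> \<le> \<alpha>"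

definition delta :: "nat \<Rightarrow> (nat \<Rightarrow> bool) \<Rightarrow> 'a::field" where
  "delta \<alpha> I = (if I = filled \<alpha> then 1 else 0)"

definition scale :: "'a::field \<Rightarrow> 'a operator" where
  "scale c f I = c * f I"

lemma chip_scale:
  "chip_U s a b u \<circ> scale c = scale c \<circ> chip_U s a b u"
  "chip_V s v a b \<circ> scale c = scale c \<circ> chip_V s v a b"
  by (auto simp: fun_eq_iff chip_U_def chip_V_def scale_def algebra_simps)

text \<open>A hop needs \<open>Suc s\<close> full and \<open>s\<close> empty. In a vacuum this
  occurs only at \<open>s = 0\<close>, since site 0 is always empty.\<close>

lemma chip_U_filled:
  "1 \<le> s \<Longrightarrow> chip_U s a b u f (filled \<alpha>) = (if s < \<alpha> then a / b else 1) * f (filled \<alpha>)"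
  by (auto simp: chip_U_def filled_def)

text \<open>Dually, a hop yields a pattern with \<open>s\<close> empty and \<open>Suc s\<close>
  full, which is no vacuum for \<open>1 \<le> s\<close>.\<close>

lemma chip_V_delta:
  assumes "1 \<le> s"
  shows "chip_V s v a b (delta \<alpha>) = scale (if s \<le> \<alpha> then a / b else 1) (delta \<alpha>)"
proof
  fix I
  have "I(s := False, Suc s := True) \<noteq> filled \<alpha>"
  proof
    assume "I(s := False, Suc s := True) = filled \<alpha>"
    then have "filled \<alpha> (Suc s)" "\<not> filled \<alpha> s" by (metis fun_upd_apply n_not_Suc_n)+
    then show False using assms by (auto simp: filled_def)
  qed
  then show "chip_V s v a b (delta \<alpha>) I = scale (if s \<le> \<alpha> then a / b else 1) (delta \<alpha>) I"
    using assms by (auto simp: chip_V_def delta_def scale_def filled_def)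
qed

lemma row_prod_scale:
  assumes "\<And>\<beta>. 1 \<le> \<beta> \<Longrightarrow> \<beta> \<le> s \<Longrightarrow> x \<beta> \<circ> scale c = scale c \<circ> x \<beta>"
  shows "row_prod x s (scale c f) = scale c (row_prod x s f)"
  using row_prod_commute[of s x "scale c"] assms by (auto simp: fun_eq_iff)

lemma scale_simps [simp]: "scale 1 f = f" "scale c (scale d f) = scale (c * d) f"
  by (auto simp: scale_def)

lemma row_prod_filled:
  assumes "\<And>\<beta> f. 1 \<le> \<beta> \<Longrightarrow> \<beta> \<le> s \<Longrightarrow> x \<beta> f (filled \<alpha>) = c \<beta> * f (filled \<alpha>)"
  shows "row_prod x s f (filled \<alpha>) = (\<Prod>\<beta>=1..s. c \<beta>) * f (filled \<alpha>)"
  using assms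
proof (induction s arbitrary: f)
  case (Suc s)
  have "row_prod x s (x (Suc s) f) (filled \<alpha>) = (\<Prod>\<beta>=1..s. c \<beta>) * x (Suc s) f (filled \<alpha>)"
    by (rule Suc.IH) (simp add: Suc.prems)
  then show ?case by (simp add: Suc.prems mult.assoc)
qed simp

lemma row_prod_delta:
  assumes "\<And>\<beta>. 1 \<le> \<beta> \<Longrightarrow> \<beta> \<le> s \<Longrightarrow> x \<beta> (delta \<alpha>) = scale (c \<beta>) (delta \<alpha>)"
    and "\<And>\<beta> d. 1 \<le> \<beta> \<Longrightarrow> \<beta> \<le> s \<Longrightarrow> x \<beta> \<circ> scale d = scale d \<circ> x \<beta>"
  shows "row_prod x s (delta \<alpha>) = scale (\<Prod>\<beta>=1..s. c \<beta>) (delta \<alpha>)"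
  using assms
proof (induction s)
  case (Suc s)
  have "row_prod x s (delta \<alpha>) = scale (\<Prod>\<beta>=1..s. c \<beta>) (delta \<alpha>)"
    by (rule Suc.IH) (simp_all add: Suc.prems)
  moreover have "row_prod x s (scale d (delta \<alpha>)) = scale d (row_prod x s (delta \<alpha>))" for d
    by (rule row_prod_scale, rule Suc.prems) simp_all
  ultimately show ?case by (simp add: Suc.prems mult.commute)
qed simp

section \<open>Row operators on the surfaces\<close>

locale nonzero_T_system =
  fixes r :: nat and T :: "nat \<Rightarrow> int \<Rightarrow> int \<Rightarrow> 'a::field"
  assumes T_sys: "T_system r T"
    and T_nonzero: "\<beta> \<le> r + 1 \<Longrightarrow> T \<beta> i k \<noteq> 0"
begin

text \<open>
  The surface at height \<open>n\<close> takes the values \<open>n\<close> and \<open>n + 1\<close> in a checkerboard pattern. From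
  column \<open>i\<close> to column \<open>i + 1\<close> a low row ascends (operator \<open>U\<close>) and a high row descends
  (operator \<open>V\<close>). The primed operators take the coefficient \<open>u\<close> or \<open>v\<close> from the other column of
  the pair, as is required when the \<open>V\<close> are multiplied before the \<open>U\<close>.
\<close>

definition low :: "int \<Rightarrow> int \<Rightarrow> nat \<Rightarrow> bool" where
  "low n i \<beta> \<longleftrightarrow> even (int \<beta> + i + n)"

definition surf :: "int \<Rightarrow> nat \<Rightarrow> int \<Rightarrow> 'a" where
  "surf n \<beta> i = T \<beta> i (if low n i \<beta> then n else n + 1)"

definition opU :: "int \<Rightarrow> int \<Rightarrow> nat \<Rightarrow> 'a operator" where
  "opU n i \<beta> =
     (if low n i \<beta> then chip_U \<beta> (surf n \<beta> i) (surf n \<beta> (i + 1)) (surf n (\<beta> + 1) i) else id)"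

definition opV :: "int \<Rightarrow> int \<Rightarrow> nat \<Rightarrow> 'a operator" where
  "opV n i \<beta> =
     (if low n i \<beta> then id
      else chip_V \<beta> (surf n (\<beta> - 1) (i + 1)) (surf n \<beta> i) (surf n \<beta> (i + 1)))"

definition opU' :: "int \<Rightarrow> int \<Rightarrow> nat \<Rightarrow> 'a operator" where
  "opU' n i \<beta> =
     (if low n i \<beta> then chip_U \<beta> (surf n \<beta> i) (surf n \<beta> (i + 1)) (surf n (\<beta> + 1) (i + 1)) else id)"

definition opV' :: "int \<Rightarrow> int \<Rightarrow> nat \<Rightarrow> 'a operator" where
  "opV' n i \<beta> =
     (if low n i \<beta> then id
      else chip_V \<beta> (surf n (\<beta> - 1) i) (surf n \<beta> i) (surf n \<beta> (i + 1)))"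

lemma surf_nonzero: "\<beta> \<le> r + 1 \<Longrightarrow> surf n \<beta> i \<noteq> 0"
  by (simp add: surf_def T_nonzero)

lemma surf_boundary: "surf n 0 i = 1" "surf n (r + 1) i = 1"
  using T_sys by (auto simp: surf_def T_system_def)

lemma low_Suc: "low n (i + 1) \<beta> \<longleftrightarrow> \<not> low n i \<beta>" "low (n + 1) i \<beta> \<longleftrightarrow> \<not> low n i \<beta>"
  "low n i (Suc \<beta>) \<longleftrightarrow> \<not> low n i \<beta>"
  by (auto simp: low_def)

text \<open>If \<open>low n i \<beta>\<close>, all four factors are the identity. Otherwise raising
  the surface changes the height over \<open>(\<beta>, i + 1)\<close> from \<open>n\<close> to
  \<open>n + 2\<close> while its four neighbours stay at \<open>n + 1\<close>, so the $T$-system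
  relation there is the hypothesis of \<open>chip_exchange\<close>.\<close>

lemma op_exchange:
  assumes "1 \<le> \<beta>" "\<beta> \<le> r"
  shows "opU' (n + 1) i \<beta> \<circ> opV' (n + 1) (i + 1) \<beta> = opV n i \<beta> \<circ> opU n (i + 1) \<beta>"
proof (cases "low n i \<beta>")
  case True
  then show ?thesis by (simp add: opU'_def opV'_def opV_def opU_def low_Suc)
next
  case False
  have "T \<beta> (i + 1) (n + 1 + 1) * T \<beta> (i + 1) (n + 1 - 1) =
        T \<beta> (i + 1 + 1) (n + 1) * T \<beta> (i + 1 - 1) (n + 1) + T (\<beta> + 1) (i + 1) (n + 1) * T (\<beta> - 1) (i + 1) (n + 1)"
    using T_sys assms unfolding T_system_def by (meson atLeastAtMost_iff)
  then have "chip_U \<beta> (T \<beta> i (n + 1)) (T \<beta> (i + 1) (n + 2)) (T (\<beta> + 1) (i + 1) (n + 1)) \<circ>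
        chip_V \<beta> (T (\<beta> - 1) (i + 1) (n + 1)) (T \<beta> (i + 1) (n + 2)) (T \<beta> (i + 2) (n + 1)) =
        chip_V \<beta> (T (\<beta> - 1) (i + 1) (n + 1)) (T \<beta> i (n + 1)) (T \<beta> (i + 1) n) \<circ>
        chip_U \<beta> (T \<beta> (i + 1) n) (T \<beta> (i + 2) (n + 1)) (T (\<beta> + 1) (i + 1) (n + 1))"
    using assms by (intro chip_exchange) (simp_all add: T_nonzero algebra_simps)
  moreover have "low n (i + 1) \<beta>" "low (n + 1) i \<beta>" "\<not> low n (i + 1) (\<beta> - 1)"
      "\<not> low n (i + 1) (\<beta> + 1)" "\<not> low n (i + 2) \<beta>" "\<not> low (n + 1) (i + 1) \<beta>"
      "low (n + 1) (i + 1) (\<beta> + 1)" "low (n + 1) (i + 1) (\<beta> - 1)" "low (n + 1) (i + 2) \<beta>"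
    using assms False by (auto simp: low_def of_nat_diff)
  ultimately show ?thesis
    using False by (simp add: opU'_def opV'_def opV_def opU_def surf_def algebra_simps)
qed

definition rowU where "rowU n i = row_prod (opU n i) r"
definition rowV where "rowV n i = row_prod (opV n i) r"
definition rowU' where "rowU' n i = row_prod (opU' n i) r"
definition rowV' where "rowV' n i = row_prod (opV' n i) r"

lemma high_far: "\<not> low n i \<alpha> \<Longrightarrow> \<not> low n i \<beta> \<Longrightarrow> \<beta> < \<alpha> \<Longrightarrow> Suc \<beta> < \<alpha>"
  by (rule Suc_lessI) (auto simp: low_def)

text \<open>Both sides are interleaved row by row. On the right a \<open>U\<close> must pass the
  \<open>V\<close> of a higher row, which fails for adjacent rows; but the nontrivial rows share one
  parity and are never adjacent.\<close>

lemma row_exchange: "rowU' (n + 1) i \<circ> rowV' (n + 1) (i + 1) = rowV n i \<circ> rowU n (i + 1)"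
proof -
  have "rowU' (n + 1) i \<circ> rowV' (n + 1) (i + 1) = row_prod (\<lambda>\<beta>. opU' (n + 1) i \<beta> \<circ> opV' (n + 1) (i + 1) \<beta>) r"
    unfolding rowU'_def rowV'_def
  proof (rule row_prod_mult)
    fix \<alpha> \<beta> :: nat assume "\<beta> < \<alpha>"
    then show "opV' (n + 1) (i + 1) \<beta> \<circ> opU' (n + 1) i \<alpha> = opU' (n + 1) i \<alpha> \<circ> opV' (n + 1) (i + 1) \<beta>"
      by (simp add: opV'_def opU'_def chip_commute_U_V)
  qed
  also have "\<dots> = row_prod (\<lambda>\<beta>. opV n i \<beta> \<circ> opU n (i + 1) \<beta>) r"
    by (rule row_prod_cong) (rule op_exchange)
  also have "\<dots> = rowV n i \<circ> rowU n (i + 1)"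
    unfolding rowU_def rowV_def
  proof (rule row_prod_mult[symmetric])
    fix \<alpha> \<beta> :: nat assume "\<beta> < \<alpha>"
    then show "opU n (i + 1) \<beta> \<circ> opV n i \<alpha> = opV n i \<alpha> \<circ> opU n (i + 1) \<beta>"
      using high_far[of n i \<alpha> \<beta>] by (auto simp: opV_def opU_def low_Suc chip_commute_far)
  qed
  finally show ?thesis .
qed

text \<open>This is \<open>chip_flip\<close> with \<open>a\<close>, \<open>b\<close> the surface
  values of row \<open>s\<close> in columns \<open>i\<close>, \<open>i + 1\<close>, and
  \<open>c\<close>, \<open>d\<close> those of the row above.\<close>

lemma chip_flip_Suc:
  assumes "Suc s \<le> r" "low n i s"
  shows "opU n i s \<circ> opV n i (Suc s) = opV' n i (Suc s) \<circ> opU' n i s"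
  using assms by (simp add: opU_def opV_def opU'_def opV'_def low_Suc chip_flip surf_nonzero)

text \<open>
  The last factor is unprimed when the row \<open>s\<close> is low, since only the \<open>V\<close> of row
  \<open>s + 1\<close> turns the \<open>U\<close> of row \<open>s\<close> into its primed form.
\<close>

lemma row_flip_prefix:
  assumes "s \<le> r"
  shows "row_prod (opU n i) s \<circ> row_prod (opV n i) s =
         row_prod (opV' n i) s \<circ> row_prod (opU' n i) (s - 1) \<circ> (if s = 0 then id else opU n i s)"
  using assms
proof (induction s)
  case (Suc s)
  let ?U = "row_prod (opU n i)" and ?V = "row_prod (opV n i)"
  let ?U' = "row_prod (opU' n i)" and ?V' = "row_prod (opV' n i)"
  have IH: "?U s \<circ> ?V s = ?V' s \<circ> ?U' (s - 1) \<circ> (if s = 0 then id else opU n i s)"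
    by (rule Suc.IH) (use Suc.prems in simp)
  show ?case
  proof (cases "low n i (Suc s)")
    case True
    have comm: "?V s \<circ> opU n i (Suc s) = opU n i (Suc s) \<circ> ?V s"
      by (rule row_prod_commute) (simp add: opU_def opV_def chip_commute_U_V)
    have V: "opV n i (Suc s) = id" "opV' n i (Suc s) = id"
      using True by (simp_all add: opV_def opV'_def)
    have U's: "?U' (s - 1) \<circ> (if s = 0 then id else opU n i s) = ?U' s"
      using True by (cases s) (auto simp: opU_def opU'_def low_Suc)
    have "?U (Suc s) \<circ> ?V (Suc s) = ?U s \<circ> (opU n i (Suc s) \<circ> ?V s)"
      by (simp add: V o_assoc)
    also have "\<dots> = ?V' s \<circ> (?U' (s - 1) \<circ> (if s = 0 then id else opU n i s)) \<circ> opU n i (Suc s)"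
      by (simp only: comm[symmetric] IH o_assoc)
    finally show ?thesis by (simp only: U's) (simp add: V)
  next
    case False
    have U: "opU n i (Suc s) = id"
      using False by (simp add: opU_def)
    have far: "?U' (s - 1) \<circ> opV' n i (Suc s) = opV' n i (Suc s) \<circ> ?U' (s - 1)"
    proof (rule row_prod_commute)
      fix \<beta> assume "1 \<le> \<beta>" "\<beta> \<le> s - 1"
      then show "opU' n i \<beta> \<circ> opV' n i (Suc s) = opV' n i (Suc s) \<circ> opU' n i \<beta>"
        by (simp add: opU'_def opV'_def chip_commute_far)
    qed
    \<comment> \<open>Of the remaining \<open>U\<close> factors only that of row \<open>s\<close>
      interacts with the new \<open>V\<close>. For \<open>s = 0\<close> there is none, and both
      forms of the \<open>V\<close> of row 1 have the boundary coefficient 1.\<close>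
    have flip: "(if s = 0 then id else opU n i s) \<circ> opV n i (Suc s) =
        opV' n i (Suc s) \<circ> (if s = 0 then id else opU' n i s)"
    proof (cases "s = 0")
      case True
      then show ?thesis using False by (simp add: opV_def opV'_def surf_boundary)
    next
      case s: False
      then show ?thesis using False Suc.prems by (simp add: chip_flip_Suc low_Suc)
    qed
    have U's: "?U' (s - 1) \<circ> (if s = 0 then id else opU' n i s) = ?U' s"
      by (cases s) auto
    have "?U (Suc s) \<circ> ?V (Suc s) = ?U s \<circ> ?V s \<circ> opV n i (Suc s)"
      by (simp add: U o_assoc)
    also have "\<dots> = ?V' s \<circ> (?U' (s - 1) \<circ> ((if s = 0 then id else opU n i s) \<circ> opV n i (Suc s)))"
      by (simp only: IH o_assoc)
    also have "\<dots> = ?V' s \<circ> (?U' (s - 1) \<circ> opV' n i (Suc s)) \<circ> (if s = 0 then id else opU' n i s)"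
      by (simp only: flip o_assoc)
    also have "\<dots> = ?V' (Suc s) \<circ> (?U' (s - 1) \<circ> (if s = 0 then id else opU' n i s))"
      by (simp only: far o_assoc row_prod.simps)
    finally show ?thesis by (simp only: U's) (simp add: U del: row_prod.simps)
  qed
qed simp

lemma row_flip: "rowU n i \<circ> rowV n i = rowV' n i \<circ> rowU' n i"
proof (cases "r = 0")
  case False
  \<comment> \<open>No \<open>V\<close> above row \<open>r\<close> primes its \<open>U\<close>, but
    the coefficient there is the boundary value 1 in either column.\<close>
  have "opU n i r = opU' n i r"
    using surf_boundary by (simp add: opU_def opU'_def)
  moreover have "row_prod f (r - 1) \<circ> f r = row_prod f r" for f :: "nat \<Rightarrow> 'a operator"
    using False by (cases r) auto
  ultimately have "row_prod (opU' n i) (r - 1) \<circ> opU n i r = row_prod (opU' n i) r"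
    by metis
  then show ?thesis
    using row_flip_prefix[of r n i] False
    unfolding rowU_def rowV_def rowU'_def rowV'_def by (simp add: o_assoc[symmetric])
qed (unfold rowU_def rowV_def rowU'_def rowV'_def, simp)

section \<open>Transfer along the surface and change of height\<close>

primrec chain :: "int \<Rightarrow> int \<Rightarrow> nat \<Rightarrow> 'a operator" where
  "chain n i 0 = id"
| "chain n i (Suc m) = chain n i m \<circ> (rowU n (i + int m) \<circ> rowV n (i + int m))"

lemma chain_rec_left: "chain n i (Suc m) = rowU n i \<circ> rowV n i \<circ> chain n (i + 1) m"
proof (induction m)
  case (Suc m)
  have "chain n i (Suc (Suc m)) = rowU n i \<circ> rowV n i \<circ> chain n (i + 1) m \<circ>
      (rowU n (i + int (Suc m)) \<circ> rowV n (i + int (Suc m)))"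
    by (subst chain.simps(2)) (simp only: Suc.IH)
  also have "i + int (Suc m) = i + 1 + int m" by simp
  finally show ?case by (simp add: o_assoc)
qed simp

text \<open>After \<open>row_flip\<close> the upper product regroups into pairs
  \<open>rowU'\<close>, \<open>rowV'\<close> in consecutive columns; \<open>row_exchange\<close>
  lowers each pair, and the results regroup into the lower chain.\<close>

lemma chain_lower:
  "rowU' (n + 1) i \<circ> chain (n + 1) (i + 1) m \<circ> rowV' (n + 1) (i + 1 + int m) =
   rowV n i \<circ> chain n (i + 1) m \<circ> rowU n (i + 1 + int m)"
proof (induction m)
  case 0
  then show ?case by (simp add: row_exchange)
next
  case (Suc m)
  let ?j = "i + 1 + int m"
  have j: "i + 1 + int (Suc m) = ?j + 1" by simp
  have "rowU' (n + 1) i \<circ> chain (n + 1) (i + 1) (Suc m) \<circ> rowV' (n + 1) (?j + 1) =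
        (rowU' (n + 1) i \<circ> chain (n + 1) (i + 1) m \<circ> rowV' (n + 1) ?j) \<circ>
        (rowU' (n + 1) ?j \<circ> rowV' (n + 1) (?j + 1))"
    by (simp only: chain.simps row_flip o_assoc)
  also have "\<dots> = rowV n i \<circ> chain n (i + 1) (Suc m) \<circ> rowU n (?j + 1)"
    by (simp only: Suc.IH row_exchange chain.simps o_assoc)
  finally show ?case by (simp only: j)
qed

lemma row_scale:
  "rowU n i (scale c f) = scale c (rowU n i f)" "rowV n i (scale c f) = scale c (rowV n i f)"
  unfolding rowU_def rowV_def
  by (rule row_prod_scale; simp add: opU_def opV_def chip_scale)+

lemma chain_scale: "chain n i m (scale c f) = scale c (chain n i m f)"
  by (induction m arbitrary: f) (simp_all add: row_scale)

section \<open>Vacuum amplitudes and their normalisation\<close>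

definition weightU :: "nat \<Rightarrow> int \<Rightarrow> int \<Rightarrow> 'a" where
  "weightU \<alpha> n i =
     (\<Prod>\<beta>=1..r. if low n i \<beta> \<and> \<beta> < \<alpha> then surf n \<beta> i / surf n \<beta> (i + 1) else 1)"

definition weightV :: "nat \<Rightarrow> int \<Rightarrow> int \<Rightarrow> 'a" where
  "weightV \<alpha> n i =
     (\<Prod>\<beta>=1..r. if \<not> low n i \<beta> \<and> \<beta> \<le> \<alpha> then surf n \<beta> i / surf n \<beta> (i + 1) else 1)"

lemma row_filled:
  "rowU n i f (filled \<alpha>) = weightU \<alpha> n i * f (filled \<alpha>)"
  "rowU' n i f (filled \<alpha>) = weightU \<alpha> n i * f (filled \<alpha>)"
  unfolding rowU_def rowU'_def weightU_def
  by (rule row_prod_filled; simp add: opU_def opU'_def chip_U_filled)+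

lemma row_delta:
  "rowV n i (delta \<alpha>) = scale (weightV \<alpha> n i) (delta \<alpha>)"
  "rowV' n i (delta \<alpha>) = scale (weightV \<alpha> n i) (delta \<alpha>)"
  unfolding rowV_def rowV'_def weightV_def
  by (rule row_prod_delta; simp add: opV_def opV'_def chip_V_delta chip_scale)+

definition amplitude :: "nat \<Rightarrow> int \<Rightarrow> int \<Rightarrow> nat \<Rightarrow> 'a" where
  "amplitude \<alpha> n i m = chain n i m (delta \<alpha>) (filled \<alpha>)"

text \<open>Splitting off the outermost \<open>rowU\<close> and \<open>rowV\<close> leaves the
  right-hand side of \<open>chain_lower\<close>. All four end operators then act on the vacuum by
  scalars.\<close>

lemma amplitude_lower:
  "amplitude \<alpha> n i (m + 2) =
     weightU \<alpha> n i * weightU \<alpha> (n + 1) i *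
     (weightV \<alpha> n (i + 1 + int m) * weightV \<alpha> (n + 1) (i + 1 + int m)) *
     amplitude \<alpha> (n + 1) (i + 1) m"
proof -
  let ?j = "i + 1 + int m"
  have "chain n i (Suc (Suc m)) = rowU n i \<circ> (rowV n i \<circ> chain n (i + 1) m \<circ> rowU n ?j) \<circ> rowV n ?j"
    by (subst chain_rec_left) (simp only: chain.simps o_assoc)
  also have "\<dots> = rowU n i \<circ> (rowU' (n + 1) i \<circ> chain (n + 1) (i + 1) m \<circ> rowV' (n + 1) ?j) \<circ> rowV n ?j"
    by (simp only: chain_lower)
  finally have "chain n i (m + 2) (delta \<alpha>) (filled \<alpha>) =
      rowU n i (rowU' (n + 1) i (chain (n + 1) (i + 1) m (rowV' (n + 1) ?j (rowV n ?j (delta \<alpha>))))) (filled \<alpha>)"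
    by simp
  moreover have "rowV' (n + 1) ?j (scale c f) = scale c (rowV' (n + 1) ?j f)" for c f
    unfolding rowV'_def by (rule row_prod_scale) (simp add: opV'_def chip_scale)
  ultimately show ?thesis
    by (simp add: amplitude_def row_filled row_delta chain_scale) (simp add: scale_def)
qed

text \<open>The end weights in \<open>amplitude_lower\<close> are quotients of such column products
  at the ends of the long and the short stretch, so \<open>network\<close> cancels them.\<close>

definition norm_left :: "nat \<Rightarrow> int \<Rightarrow> int \<Rightarrow> 'a" where
  "norm_left \<alpha> n i = (\<Prod>\<beta>=1..r. if \<beta> < \<alpha> then surf n \<beta> i else 1)"

definition norm_right :: "nat \<Rightarrow> int \<Rightarrow> int \<Rightarrow> 'a" where
  "norm_right \<alpha> n i = (\<Prod>\<beta>=1..r. if \<beta> \<le> \<alpha> then surf n \<beta> i else 1)"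

lemma norm_nonzero: "norm_left \<alpha> n i \<noteq> 0" "norm_right \<alpha> n i \<noteq> 0"
  by (auto simp: norm_left_def norm_right_def surf_nonzero)

text \<open>In each row \<open>low\<close> alternates with \<open>n\<close>, so at most one of the
  two weights contributes. Its denominator cancels because the surfaces at heights \<open>n\<close>
  and \<open>n + 1\<close> coincide at the high points of the former.\<close>

lemma weightU_norm: "weightU \<alpha> n i * weightU \<alpha> (n + 1) i * norm_left \<alpha> (n + 1) (i + 1) = norm_left \<alpha> n i"
  unfolding weightU_def norm_left_def prod.distrib[symmetric]
proof (rule prod.cong[OF refl])
  fix \<beta> assume "\<beta> \<in> {1..r}"
  then have nz: "surf n' \<beta> i' \<noteq> 0" "T \<beta> i' k \<noteq> 0" for n' i' k by (simp_all add: surf_nonzero T_nonzero)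
  show "(if low n i \<beta> \<and> \<beta> < \<alpha> then surf n \<beta> i / surf n \<beta> (i + 1) else 1) *
      (if low (n + 1) i \<beta> \<and> \<beta> < \<alpha> then surf (n + 1) \<beta> i / surf (n + 1) \<beta> (i + 1) else 1) *
      (if \<beta> < \<alpha> then surf (n + 1) \<beta> (i + 1) else 1) = (if \<beta> < \<alpha> then surf n \<beta> i else 1)"
    using nz by (simp add: low_Suc surf_def)
qed

lemma weightV_norm: "weightV \<alpha> n i * weightV \<alpha> (n + 1) i * norm_right \<alpha> n (i + 1) = norm_right \<alpha> (n + 1) i"
  unfolding weightV_def norm_right_def prod.distrib[symmetric]
proof (rule prod.cong[OF refl])
  fix \<beta> assume "\<beta> \<in> {1..r}"
  then have nz: "surf n' \<beta> i' \<noteq> 0" "T \<beta> i' k \<noteq> 0" for n' i' k by (simp_all add: surf_nonzero T_nonzero)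
  show "(if \<not> low n i \<beta> \<and> \<beta> \<le> \<alpha> then surf n \<beta> i / surf n \<beta> (i + 1) else 1) *
      (if \<not> low (n + 1) i \<beta> \<and> \<beta> \<le> \<alpha> then surf (n + 1) \<beta> i / surf (n + 1) \<beta> (i + 1) else 1) *
      (if \<beta> \<le> \<alpha> then surf n \<beta> (i + 1) else 1) = (if \<beta> \<le> \<alpha> then surf (n + 1) \<beta> i else 1)"
    using nz by (simp add: low_Suc surf_def)
qed

definition network :: "nat \<Rightarrow> int \<Rightarrow> int \<Rightarrow> nat \<Rightarrow> 'a" where
  "network \<alpha> n i m = amplitude \<alpha> n i m * norm_right \<alpha> n (i + int m) / norm_left \<alpha> n i"

lemma network_lower: "network \<alpha> n i (m + 2) = network \<alpha> (n + 1) (i + 1) m"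
proof -
  let ?j = "i + 1 + int m"
  have "norm_right \<alpha> n (i + int (m + 2)) = norm_right \<alpha> n (?j + 1)" by (simp add: algebra_simps)
  moreover have "weightV \<alpha> n ?j * weightV \<alpha> (n + 1) ?j * norm_right \<alpha> n (?j + 1) = norm_right \<alpha> (n + 1) ?j"
    by (rule weightV_norm)
  moreover note weightU_norm[of \<alpha> n i, symmetric] norm_nonzero(1)[of \<alpha> n i]
  ultimately show ?thesis
    unfolding network_def amplitude_lower by (simp add: field_simps)
qed

text \<open>The empty chain has amplitude 1, and the two norms differ by the single factor of row
  \<open>\<alpha>\<close>.\<close>

lemma network_0:
  assumes "1 \<le> \<alpha>" "\<alpha> \<le> r"
  shows "network \<alpha> n i 0 = surf n \<alpha> i"
proof -
  have "norm_right \<alpha> n i = norm_left \<alpha> n i * (\<Prod>\<beta>=1..r. if \<beta> = \<alpha> then surf n \<beta> i else 1)"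
    unfolding norm_right_def norm_left_def prod.distrib[symmetric]
    by (rule prod.cong) auto
  also have "(\<Prod>\<beta>=1..r. if \<beta> = \<alpha> then surf n \<beta> i else 1) = surf n \<alpha> i"
    using assms by (simp add: prod.delta)
  finally show ?thesis
    using norm_nonzero by (simp add: network_def amplitude_def delta_def)
qed

lemma network_level: "network \<alpha> n i (2 * k + m) = network \<alpha> (n + int k) (i + int k) m"
proof (induction k arbitrary: n i)
  case (Suc k)
  have "network \<alpha> n i (2 * Suc k + m) = network \<alpha> (n + 1) (i + 1) (2 * k + m)"
    using network_lower[of \<alpha> n i "2 * k + m"] by (simp add: algebra_simps)
  then show ?case using Suc by (simp add: algebra_simps)
qed simp

text \<open>The parity makes \<open>(\<alpha>, j)\<close> low at height \<open>k\<close>. The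
  stretch at height 0 is the base of the cone below that point.\<close>

lemma T_eq_network:
  assumes "1 \<le> \<alpha>" "\<alpha> \<le> r" "even (int \<alpha> + j + int k)"
  shows "T \<alpha> j (int k) = network \<alpha> 0 (j - int k) (2 * k)"
  using assms network_level[of \<alpha> 0 "j - int k" k 0] by (simp add: network_0 surf_def low_def)

end

section \<open>Closure of the network values in a subsemiring\<close>

locale subsemiring =
  fixes P :: "'a::field \<Rightarrow> bool"
  assumes P_0: "P 0" and P_1: "P 1"
    and P_add: "P x \<Longrightarrow> P y \<Longrightarrow> P (x + y)"
    and P_mult: "P x \<Longrightarrow> P y \<Longrightarrow> P (x * y)"
begin

lemma P_divide: "P x \<Longrightarrow> P (inverse y) \<Longrightarrow> P (x / y)"
  by (simp add: divide_inverse P_mult)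

lemma P_prod: "(\<And>x. x \<in> A \<Longrightarrow> P (f x)) \<Longrightarrow> P (\<Prod>x\<in>A. f x)"
  by (induction A rule: infinite_finite_induct) (auto simp: P_1 P_mult)

lemma chip_closed:
  assumes "P a" "P (inverse b)" "P u" "\<And>I. P (f I)"
  shows "P (chip_U s a b u f I)" "P (chip_V s u a b f I)"
  using assms by (auto simp: chip_U_def chip_V_def P_0 intro!: P_add P_mult P_divide)

lemma row_prod_closed:
  assumes "\<And>\<beta> f I. 1 \<le> \<beta> \<Longrightarrow> \<beta> \<le> s \<Longrightarrow> (\<And>I. P (f I)) \<Longrightarrow> P (x \<beta> f I)" "\<And>I. P (f I)"
  shows "P (row_prod x s f I)"
  using assms
proof (induction s arbitrary: f I)
  case (Suc s)
  have "P (row_prod x s (x (Suc s) f) I)"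
    by (rule Suc.IH) (simp_all add: Suc.prems)
  then show ?case by simp
qed simp

end

text \<open>Kept general in \<open>T\<close> so that it can be interpreted again for shifted and
  reflected solutions.\<close>

locale positive_T_system = nonzero_T_system r T + subsemiring P
  for r and T :: "nat \<Rightarrow> int \<Rightarrow> int \<Rightarrow> 'a::field" and P +
  assumes P_init: "\<beta> \<in> {1..r} \<Longrightarrow> k \<in> {0, 1} \<Longrightarrow> P (T \<beta> i k) \<and> P (inverse (T \<beta> i k))"
begin

text \<open>The surface at height 0 meets only the heights 0 and 1, that is, initial data and
  boundary values.\<close>

lemma surf_closed: "\<beta> \<le> r + 1 \<Longrightarrow> P (surf 0 \<beta> i) \<and> P (inverse (surf 0 \<beta> i))"
proof (cases "\<beta> \<in> {1..r}")
  case True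
  then show ?thesis using P_init by (simp add: surf_def)
next
  case False
  moreover assume "\<beta> \<le> r + 1"
  ultimately have "\<beta> = 0 \<or> \<beta> = r + 1" by auto
  then show ?thesis using surf_boundary P_1 by fastforce
qed

lemma chain_closed: "(\<And>I. P (f I)) \<Longrightarrow> P (chain 0 i m f I)"
proof (induction m arbitrary: f I)
  case (Suc m)
  have "P (rowV 0 i f I)" if "\<And>I. P (f I)" for f i I
    unfolding rowV_def
    by (rule row_prod_closed) (use that in \<open>auto simp: opV_def surf_closed intro!: chip_closed\<close>)
  moreover have "P (rowU 0 i f I)" if "\<And>I. P (f I)" for f i I
    unfolding rowU_def
    by (rule row_prod_closed) (use that in \<open>auto simp: opU_def surf_closed intro!: chip_closed\<close>)
  ultimately show ?case using Suc by simp
qed simp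

lemma network_closed: "P (network \<alpha> 0 i m)"
proof -
  have "P (inverse (norm_left \<alpha> 0 i))"
    unfolding norm_left_def prod_inversef[symmetric] comp_def
    by (rule P_prod) (simp add: surf_closed P_1)
  moreover have "P (norm_right \<alpha> 0 (i + int m))"
    unfolding norm_right_def by (rule P_prod) (simp add: surf_closed P_1)
  moreover have "P (amplitude \<alpha> 0 i m)"
    unfolding amplitude_def by (rule chain_closed) (simp add: delta_def P_0 P_1)
  ultimately show ?thesis
    by (simp add: network_def P_mult P_divide)
qed

lemma T_closed_even:
  assumes "\<alpha> \<in> {1..r}" "0 \<le> k" "even (int \<alpha> + j + k)"
  shows "P (T \<alpha> j k)"
  using T_eq_network[of \<alpha> j "nat k"] assms network_closed by simp

text \<open>
  The surfaces only meet the points with \<open>\<alpha> + j + k\<close> even; the odd ones are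
  reached by shifting \<open>j\<close>, and negative \<open>k\<close> by the reflection \<open>k \<mapsto> 1 - k\<close>.
\<close>

lemma T_closed_nonneg:
  assumes "\<alpha> \<in> {1..r}" "0 \<le> k"
  shows "P (T \<alpha> j k)"
proof (cases "even (int \<alpha> + j + k)")
  case True
  then show ?thesis using assms T_closed_even by simp
next
  case False
  interpret shift: positive_T_system r "\<lambda>\<beta> i. T \<beta> (i + 1)" P
  proof
    show "T_system r (\<lambda>\<beta> i. T \<beta> (i + 1))"
      using T_sys by (simp add: T_system_def)
  qed (simp_all add: T_nonzero P_init)
  have "P (T \<alpha> (j - 1 + 1) k)"
    using assms False by (intro shift.T_closed_even) auto
  then show ?thesis by simp
qed

lemma T_closed:
  assumes "\<alpha> \<in> {1..r}"
  shows "P (T \<alpha> j k)"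
proof (cases "0 \<le> k")
  case True
  then show ?thesis using assms T_closed_nonneg by simp
next
  case False
  \<comment> \<open>The reflection swaps the two initial slices and the two factors on the left of
    the $T$-system relation.\<close>
  interpret reflect: positive_T_system r "\<lambda>\<beta> i l. T \<beta> i (1 - l)" P
  proof
    have "T \<alpha> j (1 - (k + 1)) * T \<alpha> j (1 - (k - 1)) =
        T \<alpha> (j + 1) (1 - k) * T \<alpha> (j - 1) (1 - k) + T (\<alpha> + 1) j (1 - k) * T (\<alpha> - 1) j (1 - k)"
      if "\<alpha> \<in> {1..r}" for \<alpha> j k
    proof -
      have "1 - (k - 1) = 1 - k + 1" "1 - (k + 1) = 1 - k - 1" by simp_all
      then show ?thesis using T_sys that unfolding T_system_def by (metis mult.commute)
    qed
    then show "T_system r (\<lambda>\<beta> i l. T \<beta> i (1 - l))"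
      using T_sys by (simp add: T_system_def)
  qed (use T_nonzero P_init in auto)
  have "P (T \<alpha> j (1 - (1 - k)))"
    using assms False by (intro reflect.T_closed_nonneg) auto
  then show ?thesis by simp
qed

end

section \<open>The semiring of positive Laurent polynomials\<close>

lemma positive_laurent_monom:
  assumes "0 \<le> c" "Poly_Mapping.keys m \<subseteq> V"
  shows "positive_laurent V (of_int c * laurent_monom m)"
  unfolding positive_laurent_def
proof (intro exI conjI)
  show "of_int c * laurent_monom m = laurent_eval (Poly_Mapping.single m c)"
    by (simp add: laurent_eval_def)
qed (use assms in \<open>auto simp: lookup_single when_def split: if_splits\<close>)

text \<open>Padding with zero coefficients puts \<open>p\<close>, \<open>q\<close> and
  \<open>p + q\<close> over one index set.\<close>

lemma laurent_eval_superset: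
  assumes "finite S" "Poly_Mapping.keys p \<subseteq> S"
  shows "laurent_eval p = (\<Sum>m\<in>S. of_int (Poly_Mapping.lookup p m) * laurent_monom m)"
  unfolding laurent_eval_def
  by (rule sum.mono_neutral_left) (use assms in \<open>auto simp: in_keys_iff\<close>)

lemma laurent_eval_add: "laurent_eval (p + q) = laurent_eval p + laurent_eval q"
proof -
  let ?S = "Poly_Mapping.keys p \<union> Poly_Mapping.keys q"
  have "laurent_eval f = (\<Sum>m\<in>?S. of_int (Poly_Mapping.lookup f m) * laurent_monom m)"
    if "f \<in> {p, q, p + q}" for f
    by (rule laurent_eval_superset) (use that Poly_Mapping.keys_add[of p q] in auto)
  then show ?thesis
    by (simp add: lookup_add sum.distrib distrib_right)
qed

lemma positive_laurent_add:
  assumes "positive_laurent V f" "positive_laurent V g"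
  shows "positive_laurent V (f + g)"
proof -
  obtain p q where
    "\<forall>m\<in>Poly_Mapping.keys p. Poly_Mapping.keys m \<subseteq> V \<and> Poly_Mapping.lookup p m \<ge> 0" "f = laurent_eval p"
    "\<forall>m\<in>Poly_Mapping.keys q. Poly_Mapping.keys m \<subseteq> V \<and> Poly_Mapping.lookup q m \<ge> 0" "g = laurent_eval q"
    using assms unfolding positive_laurent_def by blast
  moreover have "0 \<le> Poly_Mapping.lookup h m"
    if "\<forall>m\<in>Poly_Mapping.keys h. Poly_Mapping.keys m \<subseteq> V \<and> Poly_Mapping.lookup h m \<ge> 0" for h :: laurent and m
    using that by (cases "m \<in> Poly_Mapping.keys h") (auto simp: in_keys_iff)
  ultimately show ?thesis
    unfolding positive_laurent_def
    by (intro exI[of _ "p + q"])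
       (use Poly_Mapping.keys_add[of p q] in \<open>auto simp: laurent_eval_add lookup_add; blast\<close>)
qed

lemma positive_laurent_0: "positive_laurent V 0"
  unfolding positive_laurent_def by (intro exI[of _ 0]) (simp add: laurent_eval_def)

lemma positive_laurent_sum:
  "(\<And>x. x \<in> A \<Longrightarrow> positive_laurent V (f x)) \<Longrightarrow> positive_laurent V (sum f A)"
  by (induction A rule: infinite_finite_induct) (auto simp: positive_laurent_0 positive_laurent_add)

lemma laurent_monom_superset:
  assumes "finite S" "Poly_Mapping.keys m \<subseteq> S"
  shows "laurent_monom m = (\<Prod>v\<in>S. indet v powi Poly_Mapping.lookup m v)"
  unfolding laurent_monom_def
  by (rule prod.mono_neutral_left) (use assms in \<open>auto simp: in_keys_iff\<close>)

lemma indet_nonzero: "indet v \<noteq> 0"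
  using subtraction_free_indet subtraction_free_nonzero by blast

lemma laurent_monom_add: "laurent_monom (m + n) = laurent_monom m * laurent_monom n"
proof -
  let ?S = "Poly_Mapping.keys m \<union> Poly_Mapping.keys n"
  have "laurent_monom f = (\<Prod>v\<in>?S. indet v powi Poly_Mapping.lookup f v)"
    if "f \<in> {m, n, m + n}" for f
    by (rule laurent_monom_superset) (use that Poly_Mapping.keys_add[of m n] in auto)
  then show ?thesis
    by (simp add: lookup_add power_int_add indet_nonzero prod.distrib)
qed

text \<open>The product is expanded into monomial terms, each positive, so no convolution of
  coefficients has to be evaluated.\<close>

lemma positive_laurent_mult:
  assumes "positive_laurent V f" "positive_laurent V g"
  shows "positive_laurent V (f * g)"
proof -
  obtain p q where
    p: "\<forall>m\<in>Poly_Mapping.keys p. Poly_Mapping.keys m \<subseteq> V \<and> Poly_Mapping.lookup p m \<ge> 0" "f = laurent_eval p" and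
    q: "\<forall>m\<in>Poly_Mapping.keys q. Poly_Mapping.keys m \<subseteq> V \<and> Poly_Mapping.lookup q m \<ge> 0" "g = laurent_eval q"
    using assms unfolding positive_laurent_def by blast
  have "f * g = (\<Sum>m\<in>Poly_Mapping.keys p. \<Sum>n\<in>Poly_Mapping.keys q.
      of_int (Poly_Mapping.lookup p m * Poly_Mapping.lookup q n) * laurent_monom (m + n))"
    by (simp add: p q laurent_eval_def sum_product laurent_monom_add mult_ac)
  moreover have "positive_laurent V
      (of_int (Poly_Mapping.lookup p m * Poly_Mapping.lookup q n) * laurent_monom (m + n))"
    if "m \<in> Poly_Mapping.keys p" "n \<in> Poly_Mapping.keys q" for m n
    using that p q Poly_Mapping.keys_add[of m n] by (intro positive_laurent_monom) fastforce+
  ultimately show ?thesis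
    by (simp only: positive_laurent_sum)
qed

lemma positive_laurent_1: "positive_laurent V 1"
  using positive_laurent_monom[of 1 0 V] by (simp add: laurent_monom_def)

lemma positive_laurent_indet:
  assumes "v \<in> V"
  shows "positive_laurent V (indet v)" "positive_laurent V (inverse (indet v))"
  using assms positive_laurent_monom[of 1 "Poly_Mapping.single v 1" V]
    positive_laurent_monom[of 1 "Poly_Mapping.single v (- 1)" V]
  by (simp_all add: laurent_monom_def power_int_minus)

theorem theorem5p7:
  fixes r :: nat and T :: "nat \<Rightarrow> int \<Rightarrow> int \<Rightarrow> ratfun"
  assumes "r \<ge> 1"
    and "T_system_solution r T"
  shows "\<forall>\<alpha>\<in>{1..r}. \<forall>j k. positive_laurent (init_indices r) (T \<alpha> j k)"
proof -
  interpret positive_T_system r T "positive_laurent (init_indices r)"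
  proof
    show "T_system r T"
      using assms(2) by (simp add: T_system_solution_def)
    \<comment> \<open>Nonvanishing comes from uniqueness: \<open>T\<close> agrees with
      \<open>T_sol\<close>, whose values are subtraction-free.\<close>
    show "T \<beta> i k \<noteq> 0" if "\<beta> \<le> r + 1" for \<beta> i k
      using T_system_solution_unique[OF assms(2) that] T_sol_subtraction_free subtraction_free_nonzero
      by metis
    fix \<beta> i and k :: int assume "\<beta> \<in> {1..r}" "k \<in> {0, 1}"
    then have "(\<beta>, i, k) \<in> init_indices r" "T \<beta> i k = indet (\<beta>, i, k)"
      using assms(2) by (auto simp: T_system_solution_def init_indices_def)
    then show "positive_laurent (init_indices r) (T \<beta> i k) \<and>
        positive_laurent (init_indices r) (inverse (T \<beta> i k))"
      by (simp add: positive_laurent_indet)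
  qed (simp_all add: positive_laurent_0 positive_laurent_1 positive_laurent_add positive_laurent_mult)
  show ?thesis using T_closed by blast
qed

end
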